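(* Let $T>0$, $X\in C^2([0,T]^2;\mathbb{R}^d)$, and let $\phi:[0,T]^2\to[0,T]^2$ be a stretching, i.e. a continuously differentiable function of the form $\phi(t_1,t_2)=(\phi_1(t_1),\phi_2(t_2))$ with $\phi_i:[0,T]\to[0,T]$ monotone, $\phi_i(0)=0$ and $\phi_i(T)=T$ for $i=1,2$. Set $X^\phi(t_1,t_2)=X(\phi(t_1,t_2))$. Then for all $\mathbf s=(s_1,s_2),\mathbf t=(t_1,t_2)\in[0,T]^2$ with $s_1\le t_1$, $s_2\le t_2$, $$\mathbf S_{\mathbf s\mathbf t}(X^\phi)=\mathbf S_{\phi(\mathbf s),\phi(\mathbf t)}(X),$$ i.e. $\langle\mathbf S_{\mathbf s\mathbf t}(X^\phi),(w,\nu)\rangle=\langle\mathbf S_{\phi(\mathbf s),\phi(\mathbf t)}(X),(w,\nu)\rangle$ for all words $w=(w_1,\dots,w_n)$ in $\{1,\dots,d\}$ and all permutations $\nu$ of $\{1,\dots,n\}$. In particular, the 2D signature over $[0,T]^2$ is invariant to stretching: $\mathbf S_{\mathbf 0\mathbf T}(X^\phi)=\mathbf S_{\mathbf 0\mathbf T}(X)$, where $\mathbf 0=(0,0)$, $\mathbf T=(T,T)$.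
   Context: Full 2D signature of a field $Z:[0,T]^2\to\mathbb R^d$ whose mixed partial derivative $\partial_{12}Z=\frac{\partial^2Z}{\partial r_1\partial r_2}$ exists and is continuous: $$\langle \mathbf S_{\mathbf s\mathbf t}(Z),(w,\nu)\rangle=\int_{\Delta^n_{[\mathbf s,\mathbf t]}}\prod_{i=1}^n\partial_{12}Z^{w_i}(r_1^i,r_2^{\nu(i)})\,d\mathbf r^1\cdots d\mathbf r^n,$$ where $\mathbf r^i=(r_1^i,r_2^i)$ and $\Delta^n_{[\mathbf s,\mathbf t]}=\{(\mathbf r^1,\dots,\mathbf r^n): s_1\le r_1^1\le\dots\le r_1^n\le t_1,\ s_2\le r_2^1\le\dots\le r_2^n\le t_2\}$ (value $1$ for the empty word). For $X\in C^2$ and $\phi$ a stretching, $\partial_{12}X^\phi=(\partial_{12}X)(\phi)\,\phi_1'\,\phi_2'$ is continuous, so $\mathbf S(X^\phi)$ is defined. *)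

theory Defs
  imports "HOL-Analysis.Analysis"
begin

text \<open>
  Derivatives on a closed set \<open>S\<close> are taken within \<open>S\<close>; on a square or an interval with
  nonempty interior they are unique, and at boundary points they are one-sided.
\<close>

definition C1_on :: "'a::real_normed_vector set \<Rightarrow> ('a \<Rightarrow> 'b::real_normed_vector) \<Rightarrow> bool" where
  "C1_on S f \<longleftrightarrow>
     (\<exists>D :: 'a \<Rightarrow> 'a \<Rightarrow>\<^sub>L 'b.
        (\<forall>p\<in>S. (f has_derivative blinfun_apply (D p)) (at p within S)) \<and> continuous_on S D)"

definition C2_on :: "'a::real_normed_vector set \<Rightarrow> ('a \<Rightarrow> 'b::real_normed_vector) \<Rightarrow> bool" where
  "C2_on S f \<longleftrightarrow>
     (\<exists>D :: 'a \<Rightarrow> 'a \<Rightarrow>\<^sub>L 'b.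
        (\<forall>p\<in>S. (f has_derivative blinfun_apply (D p)) (at p within S)) \<and> C1_on S D)"

definition square :: "real \<Rightarrow> (real \<times> real) set" where
  "square T = {0..T} \<times> {0..T}"

definition stretching :: "real \<Rightarrow> (real \<times> real \<Rightarrow> real \<times> real) \<Rightarrow> bool" where
  "stretching T \<phi> \<longleftrightarrow>
     C1_on (square T) \<phi> \<and>
     (\<exists>\<phi>1 \<phi>2.
        (\<forall>x\<in>{0..T}. \<forall>y\<in>{0..T}. \<phi> (x, y) = (\<phi>1 x, \<phi>2 y)) \<and>
        \<phi>1 \<in> {0..T} \<rightarrow> {0..T} \<and> mono_on {0..T} \<phi>1 \<and> \<phi>1 0 = 0 \<and> \<phi>1 T = T \<and>
        \<phi>2 \<in> {0..T} \<rightarrow> {0..T} \<and> mono_on {0..T} \<phi>2 \<and> \<phi>2 0 = 0 \<and> \<phi>2 T = T)"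

text \<open>The iterated derivative \<open>\<partial>/\<partial>r\<^sub>1 (\<partial>Z/\<partial>r\<^sub>2)\<close> of a field on \<open>[0,T]\<^sup>2\<close>.\<close>

definition partial2 ::
    "real \<Rightarrow> (real \<times> real \<Rightarrow> 'b::real_normed_vector) \<Rightarrow> real \<times> real \<Rightarrow> 'b" where
  "partial2 T Z r = vector_derivative (\<lambda>y. Z (fst r, y)) (at (snd r) within {0..T})"

definition partial12 ::
    "real \<Rightarrow> (real \<times> real \<Rightarrow> 'b::real_normed_vector) \<Rightarrow> real \<times> real \<Rightarrow> 'b" where
  "partial12 T Z r = vector_derivative (\<lambda>x. partial2 T Z (x, snd r)) (at (fst r) within {0..T})"

text \<open>
  Indices run over \<open>0, \<dots>, n - 1\<close>.  A point of \<open>(\<real>\<^sup>2)\<^sup>n\<close> is an extensional function on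
  \<open>{..<n}\<close>, matching the carrier of the product measure used below.
\<close>

definition simplex2D ::
    "nat \<Rightarrow> real \<times> real \<Rightarrow> real \<times> real \<Rightarrow> (nat \<Rightarrow> real \<times> real) set" where
  "simplex2D n s t =
     {r \<in> {..<n} \<rightarrow>\<^sub>E UNIV.
        (\<forall>i<n. fst s \<le> fst (r i) \<and> fst (r i) \<le> fst t \<and>
               snd s \<le> snd (r i) \<and> snd (r i) \<le> snd t) \<and>
        mono_on {..<n} (\<lambda>i. fst (r i)) \<and> mono_on {..<n} (\<lambda>i. snd (r i))}"

text \<open>
  The coefficient of the full 2D signature at \<open>(w, \<nu>)\<close>, where \<open>\<nu>\<close> is meant to permute
  \<open>{..<length w}\<close>.  For the empty word the product measure is a unit point mass, so the
  value is \<open>1\<close>.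
\<close>

definition sig2D ::
    "real \<Rightarrow> (real \<times> real \<Rightarrow> real ^ 'd) \<Rightarrow> real \<times> real \<Rightarrow> real \<times> real \<Rightarrow>
     'd::finite list \<Rightarrow> (nat \<Rightarrow> nat) \<Rightarrow> real" where
  "sig2D T Z s t w \<nu> =
     (LINT r : simplex2D (length w) s t | (\<Pi>\<^sub>M i\<in>{..<length w}. lborel).
        (\<Prod>i<length w. partial12 T Z (fst (r i), snd (r (\<nu> i))) $ (w ! i)))"

lemma sig2D_Nil: "sig2D T Z s t [] \<nu> = 1"
proof -
  have "(\<lambda>_. undefined) \<in> simplex2D 0 s t"
    by (auto simp: simplex2D_def mono_on_def)
  then show ?thesis
    by (simp add: sig2D_def set_lebesgue_integral_def PiM_empty lebesgue_integral_count_space_finite)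
qed

end

theory Submission
  imports Defs
begin

text \<open>
  The one-dimensional substitution rule says that \<open>\<phi>\<^sub>i\<close> pushes the measure \<open>\<phi>\<^sub>i'(x) dx\<close> on
  \<open>[s\<^sub>i,t\<^sub>i]\<close> forward to Lebesgue measure on \<open>[\<phi>\<^sub>i(s\<^sub>i),\<phi>\<^sub>i(t\<^sub>i)]\<close>, whether or not \<open>\<phi>\<^sub>i\<close> is
  injective; this passes to products.  Since \<open>\<partial>\<^sub>1\<^sub>2X\<^sup>\<phi>\<close> carries the density \<open>\<phi>\<^sub>1'\<phi>\<^sub>2'\<close>, and permuting the
  second coordinates by \<open>\<nu>\<close> does not change its product over all points, it remains to compare the
  simplices.  A configuration in the box that is not ordered although its image is has two
  coordinates with \<open>x < y\<close> and \<open>\<phi>\<^sub>i(x) = \<phi>\<^sub>i(y)\<close>; then \<open>\<phi>\<^sub>i'(y) = 0\<close> and the integrand vanishes.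
\<close>

section \<open>Mixed partial derivatives and the chain rule on the square\<close>

text \<open>Restricting the total derivatives to lines parallel to the axes turns them into
  one-variable derivatives within \<open>{0..T}\<close>, the form in which \<open>partial2\<close>
  and \<open>partial12\<close> are defined.\<close>

lemma C2_on_square_partials:
  fixes X :: "real \<times> real \<Rightarrow> 'b::real_normed_vector"
  assumes "C2_on (square T) X"
  obtains D2 D12 where
    "\<And>x y. x \<in> {0..T} \<Longrightarrow> y \<in> {0..T} \<Longrightarrow>
       ((\<lambda>y. X (x, y)) has_vector_derivative D2 (x, y)) (at y within {0..T})"
    "\<And>x y. x \<in> {0..T} \<Longrightarrow> y \<in> {0..T} \<Longrightarrow>
       ((\<lambda>x. D2 (x, y)) has_vector_derivative D12 (x, y)) (at x within {0..T})"
    "continuous_on (square T) D12"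
proof -
  obtain D :: "real \<times> real \<Rightarrow> ((real \<times> real) \<Rightarrow>\<^sub>L 'b)"
    and E :: "real \<times> real \<Rightarrow> ((real \<times> real) \<Rightarrow>\<^sub>L ((real \<times> real) \<Rightarrow>\<^sub>L 'b))"
    where D: "\<And>p. p \<in> square T \<Longrightarrow> (X has_derivative blinfun_apply (D p)) (at p within square T)"
      and E: "\<And>p. p \<in> square T \<Longrightarrow> (D has_derivative blinfun_apply (E p)) (at p within square T)"
      and cont: "continuous_on (square T) E"
    using assms unfolding C2_on_def C1_on_def by blast
  have slice2: "((\<lambda>y. X (x, y)) has_vector_derivative D (x, y) (0, 1)) (at y within {0..T})"
    if "x \<in> {0..T}" "y \<in> {0..T}" for x y
  proof -
    have "((\<lambda>y. X (x, y)) has_derivative (\<lambda>h. D (x, y) (0, h))) (at y within {0..T})"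
      using that by (intro has_derivative_in_compose2[where g = X and t = "square T"
            and f = "\<lambda>y. (x, y)" and f' = "\<lambda>h. (0, h)" and g' = "\<lambda>p. blinfun_apply (D p)"] D)
        (auto simp: square_def intro!: derivative_eq_intros)
    moreover have "(\<lambda>h. D (x, y) (0, h)) = (\<lambda>h. h *\<^sub>R D (x, y) (0, 1))"
    proof
      fix h :: real
      have "(0, h) = h *\<^sub>R (0 :: real, 1)" by simp
      then show "D (x, y) (0, h) = h *\<^sub>R D (x, y) (0, 1)" by (simp only: blinfun.scaleR_right)
    qed
    ultimately show ?thesis by (simp only: has_vector_derivative_def)
  qed
  have slice1: "((\<lambda>x. D (x, y) (0, 1)) has_vector_derivative E (x, y) (1, 0) (0, 1)) (at x within {0..T})"
    if "x \<in> {0..T}" "y \<in> {0..T}" for x y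
  proof -
    have "((\<lambda>x. D (x, y)) has_derivative (\<lambda>h. E (x, y) (h, 0))) (at x within {0..T})"
      using that by (intro has_derivative_in_compose2[where g = D and t = "square T"
            and f = "\<lambda>x. (x, y)" and f' = "\<lambda>h. (h, 0)" and g' = "\<lambda>p. blinfun_apply (E p)"] E)
        (auto simp: square_def intro!: derivative_eq_intros)
    then have "((\<lambda>x. D (x, y) (0, 1)) has_derivative (\<lambda>h. E (x, y) (h, 0) (0, 1))) (at x within {0..T})"
      by (rule bounded_linear.has_derivative[OF blinfun.bounded_linear_left])
    moreover have "(\<lambda>h. E (x, y) (h, 0) (0, 1)) = (\<lambda>h. h *\<^sub>R E (x, y) (1, 0) (0, 1))"
    proof
      fix h :: real
      have "(h, 0) = h *\<^sub>R (1, 0 :: real)" by simp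
      then show "E (x, y) (h, 0) (0, 1) = h *\<^sub>R E (x, y) (1, 0) (0, 1)"
        by (simp only: blinfun.scaleR_right blinfun.scaleR_left)
    qed
    ultimately show ?thesis by (simp only: has_vector_derivative_def)
  qed
  \<comment> \<open>\<open>(0, 1)\<close> selects the inner derivative in the second variable and
    \<open>(1, 0)\<close> is the direction of the outer one, matching the order in
    \<open>partial12\<close>.\<close>
  have "continuous_on (square T) (\<lambda>p. E p (1, 0) (0, 1))"
    by (intro continuous_intros cont)
  with slice2 slice1 show ?thesis
    using that[of "\<lambda>p. D p (0, 1)" "\<lambda>p. E p (1, 0) (0, 1)"] by blast
qed

text \<open>Links the choice-based \<open>vector_derivative\<close> to actual derivatives:
  \<open>T > 0\<close> makes derivatives within \<open>{0..T}\<close> unique. The inner derivative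
  is asked for at all first coordinates because the outer differentiation varies them.\<close>

lemma partial12_eqI:
  fixes Z :: "real \<times> real \<Rightarrow> 'b::real_normed_vector"
  assumes "T > 0" "x \<in> {0..T}" "y \<in> {0..T}"
    and "\<And>x. x \<in> {0..T} \<Longrightarrow> ((\<lambda>y. Z (x, y)) has_vector_derivative Zy x) (at y within {0..T})"
    and "(Zy has_vector_derivative z) (at x within {0..T})"
  shows "partial12 T Z (x, y) = z"
proof -
  have "partial2 T Z (x', y) = Zy x'" if "x' \<in> {0..T}" for x'
    using vector_derivative_within_cbox[of 0 T y _ "Zy x'"] assms that by (simp add: partial2_def)
  then have "((\<lambda>x. partial2 T Z (x, y)) has_vector_derivative z) (at x within {0..T})"
    using has_vector_derivative_transform[OF assms(2) _ assms(5)] by simp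
  then show ?thesis
    using vector_derivative_within_cbox[of 0 T x _ z] assms by (simp add: partial12_def)
qed

lemma continuous_on_partial12:
  fixes X :: "real \<times> real \<Rightarrow> 'b::real_normed_vector"
  assumes "T > 0" "C2_on (square T) X"
  shows "continuous_on (square T) (partial12 T X)"
proof -
  obtain D2 D12 where
    D2: "\<And>x y. x \<in> {0..T} \<Longrightarrow> y \<in> {0..T} \<Longrightarrow>
       ((\<lambda>y. X (x, y)) has_vector_derivative D2 (x, y)) (at y within {0..T})" and
    D12: "\<And>x y. x \<in> {0..T} \<Longrightarrow> y \<in> {0..T} \<Longrightarrow>
       ((\<lambda>x. D2 (x, y)) has_vector_derivative D12 (x, y)) (at x within {0..T})" and
    cont: "continuous_on (square T) D12"
    using C2_on_square_partials[OF assms(2)] by blast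
  have "partial12 T X p = D12 p" if "p \<in> square T" for p
    using that by (cases p) (auto simp: square_def intro!: partial12_eqI[OF assms(1)] D2 D12)
  with cont show ?thesis by (simp cong: continuous_on_cong)
qed

text \<open>Two one-variable chain rules. Since \<open>g\<close> depends on the second variable
  only, \<open>g'\<close> is a constant for the differentiation in \<open>x\<close>, and no second
  derivative of the stretching arises.\<close>

lemma partial12_compose:
  fixes X :: "real \<times> real \<Rightarrow> 'b::real_normed_vector"
  assumes T: "T > 0" and X: "C2_on (square T) X"
    and \<phi>: "\<And>x y. x \<in> {0..T} \<Longrightarrow> y \<in> {0..T} \<Longrightarrow> \<phi> (x, y) = (f x, g y)"
    and f: "f ` {0..T} \<subseteq> {0..T}" and g: "g ` {0..T} \<subseteq> {0..T}"
    and x: "x \<in> {0..T}" and y: "y \<in> {0..T}"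
    and f': "(f has_real_derivative f') (at x within {0..T})"
    and g': "(g has_real_derivative g') (at y within {0..T})"
  shows "partial12 T (\<lambda>p. X (\<phi> p)) (x, y) = (f' * g') *\<^sub>R partial12 T X (f x, g y)"
proof -
  obtain D2 D12 where
    D2: "\<And>x y. x \<in> {0..T} \<Longrightarrow> y \<in> {0..T} \<Longrightarrow>
       ((\<lambda>y. X (x, y)) has_vector_derivative D2 (x, y)) (at y within {0..T})" and
    D12: "\<And>x y. x \<in> {0..T} \<Longrightarrow> y \<in> {0..T} \<Longrightarrow>
       ((\<lambda>x. D2 (x, y)) has_vector_derivative D12 (x, y)) (at x within {0..T})" and
    "continuous_on (square T) D12"
    using C2_on_square_partials[OF X] by blast
  have fx: "f x \<in> {0..T}" if "x \<in> {0..T}" for x using f that by blast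
  have gy: "g y \<in> {0..T}" using g y by blast
  have *: "((\<lambda>y. X (\<phi> (x, y))) has_vector_derivative g' *\<^sub>R D2 (f x, g y)) (at y within {0..T})"
    if x: "x \<in> {0..T}" for x
  proof -
    have "((\<lambda>y. X (f x, y)) \<circ> g has_vector_derivative g' *\<^sub>R D2 (f x, g y)) (at y within {0..T})"
      using g' has_vector_derivative_within_subset[OF D2[OF fx[OF x] gy] g]
      by (intro vector_diff_chain_within) (auto simp: has_real_derivative_iff_has_vector_derivative)
    from has_vector_derivative_transform[OF y _ this, of "\<lambda>y. X (\<phi> (x, y))"] show ?thesis
      using x by (auto simp: \<phi>)
  qed
  have "((\<lambda>x. D2 (x, g y)) \<circ> f has_vector_derivative f' *\<^sub>R D12 (f x, g y)) (at x within {0..T})"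
    using f' has_vector_derivative_within_subset[OF D12[OF fx[OF x] gy] f]
    by (intro vector_diff_chain_within) (auto simp: has_real_derivative_iff_has_vector_derivative)
  then have **: "((\<lambda>x. g' *\<^sub>R D2 (f x, g y)) has_vector_derivative g' *\<^sub>R f' *\<^sub>R D12 (f x, g y))
      (at x within {0..T})"
    unfolding comp_def by (rule bounded_linear.has_vector_derivative[OF bounded_linear_scaleR_right])
  have "partial12 T (\<lambda>p. X (\<phi> p)) (x, y) = g' *\<^sub>R f' *\<^sub>R D12 (f x, g y)"
    by (rule partial12_eqI[OF T x y, where Zy = "\<lambda>x. g' *\<^sub>R D2 (f x, g y)"], erule *, rule **)
  moreover have "partial12 T X (f x, g y) = D12 (f x, g y)"
    by (rule partial12_eqI[OF T fx[OF x] gy D2[OF _ gy] D12[OF fx[OF x] gy]])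
  ultimately show ?thesis by (simp add: mult.commute)
qed

section \<open>Monotone differentiable functions of one variable\<close>

lemma mono_on_imp_deriv_within_nonneg:
  fixes f :: "real \<Rightarrow> real"
  assumes "mono_on S f" "x \<in> S" "at x within S \<noteq> bot"
    and "(f has_real_derivative d) (at x within S)"
  shows "d \<ge> 0"
proof (rule tendsto_lowerbound[OF _ _ assms(3)])
  show "((\<lambda>y. (f y - f x) / (y - x)) \<longlongrightarrow> d) (at x within S)"
    using assms(4) by (simp add: has_field_derivative_iff)
  have "0 \<le> (f y - f x) / (y - x)" if "y \<in> S" for y
    using mono_onD[OF assms(1) \<open>x \<in> S\<close> that] mono_onD[OF assms(1) that \<open>x \<in> S\<close>]
    by (cases "x \<le> y") (auto simp: divide_simps)
  then show "\<forall>\<^sub>F y in at x within S. 0 \<le> (f y - f x) / (y - x)"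
    by (auto simp: eventually_at_filter)
qed

text \<open>Supplies two-sided derivatives on the whole line, as the substitution rule below asks
  for, whereas a stretching has only one-sided ones at the endpoints. The derivative is continued by
  its boundary values and then integrated.\<close>

lemma C1_mono_extension:
  fixes f f' :: "real \<Rightarrow> real"
  assumes "a < b" and mono: "mono_on {a..b} f"
    and deriv: "\<And>x. x \<in> {a..b} \<Longrightarrow> (f has_real_derivative f' x) (at x within {a..b})"
    and cont: "continuous_on {a..b} f'"
  obtains F F' where "\<And>x. (F has_real_derivative F' x) (at x)" "continuous_on UNIV F'"
    "\<And>x. F' x \<ge> 0" "\<And>x. x \<in> {a..b} \<Longrightarrow> F x = f x" "\<And>x. x \<in> {a..b} \<Longrightarrow> F' x = f' x"
proof -
  \<comment> \<open>\<open>c\<close> is the nearest-point projection onto \<open>{a..b}\<close>, so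
    \<open>F'\<close> is constant beyond each endpoint and stays continuous and
    non-negative.\<close>
  define c F' where "c x = max a (min b x)" and "F' x = f' (c x)" for x
  have c: "c x \<in> {a..b}" for x using \<open>a < b\<close> by (auto simp: c_def)
  have cid: "c x = x" if "x \<in> {a..b}" for x using that by (auto simp: c_def)
  have F'_cont: "continuous_on UNIV F'"
    unfolding F'_def using c
    by (intro continuous_on_compose2[OF cont]) (auto simp: c_def intro!: continuous_intros)
  have "\<exists>G. \<forall>x::real. - \<infinity> < ereal x \<longrightarrow> ereal x < \<infinity> \<longrightarrow> (G has_vector_derivative F' x) (at x)"
    using F'_cont by (intro einterval_antiderivative) (auto simp: continuous_on_eq_continuous_at)
  then obtain G where G: "(G has_real_derivative F' x) (at x)" for x
    by (auto simp: has_real_derivative_iff_has_vector_derivative)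
  \<comment> \<open>On \<open>{a..b}\<close> the antiderivative \<open>G\<close> has the same
    derivative as \<open>f\<close>, so the two differ by a constant, which is subtracted to get the
    extension.\<close>
  have "((\<lambda>x. G x - f x) has_real_derivative 0) (at x within {a..b})" if "x \<in> {a..b}" for x
    using DERIV_diff[OF has_field_derivative_at_within[OF G] deriv[OF that]] cid[OF that]
    by (simp add: F'_def)
  then obtain k where k: "G x - f x = k" if "x \<in> {a..b}" for x
    using has_field_derivative_zero_constant[of "{a..b}" "\<lambda>x. G x - f x"] by auto
  show ?thesis
  proof (rule that[of "\<lambda>x. G x - k" F'])
    show "((\<lambda>x. G x - k) has_real_derivative F' x) (at x)" for x
      using DERIV_diff[OF G[of x] DERIV_const[of k]] by simp
    have "at x within {a..b} \<noteq> bot" if "x \<in> {a..b}" for x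
      using that \<open>a < b\<close> by (simp add: trivial_limit_within islimpt_Icc)
    then show "F' x \<ge> 0" for x
      unfolding F'_def using mono_on_imp_deriv_within_nonneg[OF mono c _ deriv[OF c]] c by blast
    show "G x - k = f x" if "x \<in> {a..b}" for x using k[OF that] by simp
    show "F' x = f' x" if "x \<in> {a..b}" for x by (simp add: F'_def cid[OF that])
  qed (rule F'_cont)
qed

text \<open>Monotonicity makes \<open>F\<close> constant on \<open>{x..y}\<close>, so its left
  derivative at \<open>y\<close> is zero. This is how flat pieces of a stretching drop out of the
  integrals.\<close>

lemma mono_deriv_zero:
  fixes F :: "real \<Rightarrow> real"
  assumes "mono F" "(F has_real_derivative d) (at y)" "x < y" "F x = F y"
  shows "d = 0"
proof -
  have const: "F z = F y" if "z \<in> {x..y}" for z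
    using that monoD[OF \<open>mono F\<close>, of x z] monoD[OF \<open>mono F\<close>, of z y] \<open>F x = F y\<close> by simp
  have "(F has_real_derivative 0) (at y within {x..y})"
    using \<open>x < y\<close>
    by (rule_tac has_field_derivative_transform_within[where f = "\<lambda>_. F y" and d = 1])
      (auto intro: const[symmetric])
  moreover have "(F has_real_derivative d) (at y within {x..y})"
    using assms(2) by (rule has_field_derivative_at_within)
  ultimately show ?thesis
    using \<open>x < y\<close> vector_derivative_within_cbox[of x y y F]
    by (auto simp: has_real_derivative_iff_has_vector_derivative)
qed

section \<open>Substitution on intervals and rectangles\<close>

text \<open>For \<open>a = b\<close> both sides integrate over a single point and vanish; admitting
  this case lets degenerate rectangles be treated like all others.\<close>

lemma nn_integral_substitution_ennreal:
  fixes f :: "real \<Rightarrow> ennreal"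
  assumes [measurable]: "f \<in> borel_measurable borel"
    and "\<And>x. x \<in> {a..b} \<Longrightarrow> (g has_real_derivative g' x) (at x)"
    and "continuous_on {a..b} g'"
    and "\<And>x. x \<in> {a..b} \<Longrightarrow> g' x \<ge> 0" and "a \<le> b"
  shows "(\<integral>\<^sup>+x. f x * indicator {g a..g b} x \<partial>lborel) =
         (\<integral>\<^sup>+x. f (g x) * g' x * indicator {a..b} x \<partial>lborel)"
proof (cases "a = b")
  case True
  have "(\<integral>\<^sup>+x. h x * indicator {c..c} x \<partial>lborel) = 0" for c :: real and h :: "real \<Rightarrow> ennreal"
    by (simp add: nn_integral_indicator_singleton)
  then show ?thesis by (simp only: True)
next
  case False
  with assms show ?thesis by (intro nn_integral_substitution_aux) auto
qed

text \<open>Tonelli reduces the plane to iterated integrals; the substitution is made in the second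
  variable with the first one frozen, then in the first. The weight is a single
  \<open>ennreal\<close> of a real product so that it can serve as a density.\<close>

lemma nn_integral_substitution_rectangle:
  fixes h :: "real \<times> real \<Rightarrow> ennreal"
  assumes [measurable]: "h \<in> borel_measurable borel"
    and f: "\<And>x. (f has_real_derivative f' x) (at x)" "continuous_on UNIV f'" "\<And>x. f' x \<ge> 0"
    and g: "\<And>x. (g has_real_derivative g' x) (at x)" "continuous_on UNIV g'" "\<And>x. g' x \<ge> 0"
    and "a \<le> b" "c \<le> d"
  shows "(\<integral>\<^sup>+p. h p * indicator ({f a..f b} \<times> {g c..g d}) p \<partial>lborel) =
         (\<integral>\<^sup>+p. h (f (fst p), g (snd p)) *
            ennreal (f' (fst p) * g' (snd p) * indicator ({a..b} \<times> {c..d}) p) \<partial>lborel)"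
proof -
  have [measurable]: "f \<in> borel_measurable borel" "g \<in> borel_measurable borel"
    using DERIV_isCont[OF f(1)] DERIV_isCont[OF g(1)]
    by (auto intro!: borel_measurable_continuous_onI continuous_at_imp_continuous_on)
  have [measurable]: "f' \<in> borel_measurable borel" "g' \<in> borel_measurable borel"
    using f(2) g(2) by (auto intro: borel_measurable_continuous_onI)
  have [measurable]: "h \<in> borel_measurable (borel \<Otimes>\<^sub>M borel)"
    by (simp add: borel_prod)
  have "(\<integral>\<^sup>+p. h p * indicator ({f a..f b} \<times> {g c..g d}) p \<partial>lborel) =
      (\<integral>\<^sup>+x. \<integral>\<^sup>+y. h (x, y) * indicator {g c..g d} y * indicator {f a..f b} x \<partial>lborel \<partial>lborel)"
    unfolding lborel_prod[symmetric]
    by (subst lborel.nn_integral_fst[symmetric], measurable, intro nn_integral_cong)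
      (simp split: split_indicator)
  also have "\<dots> = (\<integral>\<^sup>+x. (\<integral>\<^sup>+y. h (x, y) * indicator {g c..g d} y \<partial>lborel) * indicator {f a..f b} x \<partial>lborel)"
    by (intro nn_integral_cong nn_integral_multc) measurable
  also have "\<dots> = (\<integral>\<^sup>+x. (\<integral>\<^sup>+y. h (x, g y) * g' y * indicator {c..d} y \<partial>lborel) * indicator {f a..f b} x \<partial>lborel)"
    by (intro nn_integral_cong, subst nn_integral_substitution_ennreal[where g' = g'])
      (use g \<open>c \<le> d\<close> in \<open>auto intro: continuous_on_subset\<close>)
  also have "\<dots> = (\<integral>\<^sup>+x. (\<integral>\<^sup>+y. h (f x, g y) * g' y * indicator {c..d} y \<partial>lborel) * f' x * indicator {a..b} x \<partial>lborel)"
    by (intro nn_integral_substitution_ennreal)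
      (use f \<open>a \<le> b\<close> in \<open>auto intro: continuous_on_subset\<close>)
  also have "\<dots> = (\<integral>\<^sup>+x. (\<integral>\<^sup>+y. h (f x, g y) * g' y * indicator {c..d} y * (ennreal (f' x) * indicator {a..b} x) \<partial>lborel) \<partial>lborel)"
    by (intro nn_integral_cong, subst nn_integral_multc) (auto simp: mult.assoc)
  also have "\<dots> = (\<integral>\<^sup>+p. h (f (fst p), g (snd p)) *
            ennreal (f' (fst p) * g' (snd p) * indicator ({a..b} \<times> {c..d}) p) \<partial>lborel)"
    unfolding lborel_prod[symmetric]
  proof (subst lborel.nn_integral_fst[symmetric], measurable, intro nn_integral_cong)
    fix x y
    show "h (f x, g y) * ennreal (g' y) * indicator {c..d} y * (ennreal (f' x) * indicator {a..b} x) =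
      h (f (fst (x, y)), g (snd (x, y))) *
        ennreal (f' (fst (x, y)) * g' (snd (x, y)) * indicator ({a..b} \<times> {c..d}) (x, y))"
      using f(3) g(3) by (simp add: ennreal_mult mult_ac split: split_indicator)
  qed
  finally show ?thesis .
qed

section \<open>Push-forwards of densities, on finite products and on rectangles\<close>

text \<open>Both sides agree with the product of the measures \<open>density N V\<close> on boxes
  \<open>Pi\<^sub>E I A\<close>, and boxes determine a product of sigma-finite measures. Finiteness
  of \<open>density N V\<close> supplies that sigma-finiteness.\<close>

lemma PiM_density_transport:
  fixes I :: "'i set" and M :: "'a measure" and N :: "'b measure"
  assumes I: "finite I" and "sigma_finite_measure M" "sigma_finite_measure N" "finite_measure (density N V)"
    and [measurable]: "W \<in> borel_measurable M" "V \<in> borel_measurable N" "\<psi> \<in> measurable M N"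
    and transport: "distr (density M W) N \<psi> = density N V"
  shows "distr (density (PiM I (\<lambda>_. M)) (\<lambda>x. \<Prod>i\<in>I. W (x i))) (PiM I (\<lambda>_. N)) (\<lambda>x. \<lambda>i\<in>I. \<psi> (x i)) =
         density (PiM I (\<lambda>_. N)) (\<lambda>x. \<Prod>i\<in>I. V (x i))" (is "?L = ?R")
proof -
  interpret M: product_sigma_finite "\<lambda>_. M" using assms by (simp add: product_sigma_finite_def)
  interpret N: product_sigma_finite "\<lambda>_. N" using assms by (simp add: product_sigma_finite_def)
  interpret V: finite_measure "density N V" by fact
  interpret P: product_sigma_finite "\<lambda>_. density N V"
    by (simp add: product_sigma_finite_def V.sigma_finite_measure_axioms)
  \<comment> \<open>On extensional functions membership in a box is decided by the coordinates in
    \<open>I\<close> alone, so its indicator factorises and the integrals below split into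
    products.\<close>
  have PiE_indicator: "indicator (Pi\<^sub>E I A) x = (\<Prod>i\<in>I. indicator (A i) (x i) :: ennreal)"
    if "x \<in> extensional I" for A :: "'i \<Rightarrow> 'b set" and x
    using that I by (auto simp: indicator_def PiE_def Pi_def)
  have "?L = PiM I (\<lambda>_. density N V)"
  proof (rule P.PiM_eqI[OF I])
    show "sets ?L = sets (PiM I (\<lambda>_. density N V))" by (simp cong: sets_PiM_cong)
    fix A assume "\<And>i. i \<in> I \<Longrightarrow> A i \<in> sets (density N V)"
    then have A: "A i \<in> sets N" if "i \<in> I" for i using that by simp
    then have [measurable]: "Pi\<^sub>E I A \<in> sets (PiM I (\<lambda>_. N))" using I by (intro sets_PiM_I_finite) auto
    have meas: "(\<lambda>x. W x * indicator (A i) (\<psi> x)) \<in> borel_measurable M" if "i \<in> I" for i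
      using A[OF that] by measurable
    have "emeasure ?L (Pi\<^sub>E I A) = (\<integral>\<^sup>+x. indicator (Pi\<^sub>E I A) x \<partial>?L)"
      by simp
    also have "\<dots> = (\<integral>\<^sup>+x. (\<Prod>i\<in>I. W (x i)) * indicator (Pi\<^sub>E I A) (\<lambda>i\<in>I. \<psi> (x i)) \<partial>PiM I (\<lambda>_. M))"
      by (subst nn_integral_distr, measurable, subst nn_integral_density) measurable
    also have "\<dots> = (\<integral>\<^sup>+x. (\<Prod>i\<in>I. W (x i) * indicator (A i) (\<psi> (x i))) \<partial>PiM I (\<lambda>_. M))"
      by (intro nn_integral_cong) (simp add: PiE_indicator prod.distrib)
    also have "\<dots> = (\<Prod>i\<in>I. \<integral>\<^sup>+x. W x * indicator (A i) (\<psi> x) \<partial>M)"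
      by (rule M.product_nn_integral_prod[OF I meas])
    also have "\<dots> = (\<Prod>i\<in>I. emeasure (distr (density M W) N \<psi>) (A i))"
    proof (intro prod.cong refl)
      fix i assume "i \<in> I"
      with A have [measurable]: "A i \<in> sets N" by blast
      have "emeasure (distr (density M W) N \<psi>) (A i) = (\<integral>\<^sup>+x. indicator (A i) x \<partial>distr (density M W) N \<psi>)"
        by simp
      also have "\<dots> = (\<integral>\<^sup>+x. W x * indicator (A i) (\<psi> x) \<partial>M)"
        by (subst nn_integral_distr, measurable, subst nn_integral_density) measurable
      finally show "(\<integral>\<^sup>+x. W x * indicator (A i) (\<psi> x) \<partial>M) = emeasure (distr (density M W) N \<psi>) (A i)" ..
    qed
    finally show "emeasure ?L (Pi\<^sub>E I A) = (\<Prod>i\<in>I. emeasure (density N V) (A i))"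
      by (simp only: transport)
  qed
  also have "\<dots> = ?R"
  proof (rule P.PiM_eqI[OF I, symmetric])
    show "sets ?R = sets (PiM I (\<lambda>_. density N V))" by (simp cong: sets_PiM_cong)
    fix A assume "\<And>i. i \<in> I \<Longrightarrow> A i \<in> sets (density N V)"
    then have A: "A i \<in> sets N" if "i \<in> I" for i using that by simp
    then have [measurable]: "Pi\<^sub>E I A \<in> sets (PiM I (\<lambda>_. N))" using I by (intro sets_PiM_I_finite) auto
    have meas: "(\<lambda>x. V x * indicator (A i) x) \<in> borel_measurable N" if "i \<in> I" for i
      using A[OF that] by measurable
    have "emeasure ?R (Pi\<^sub>E I A) = (\<integral>\<^sup>+x. (\<Prod>i\<in>I. V (x i)) * indicator (Pi\<^sub>E I A) x \<partial>PiM I (\<lambda>_. N))"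
      by (rule emeasure_density) measurable
    also have "\<dots> = (\<integral>\<^sup>+x. (\<Prod>i\<in>I. V (x i) * indicator (A i) (x i)) \<partial>PiM I (\<lambda>_. N))"
      by (intro nn_integral_cong, subst PiE_indicator) (auto simp: prod.distrib space_PiM PiE_def)
    also have "\<dots> = (\<Prod>i\<in>I. \<integral>\<^sup>+x. V x * indicator (A i) x \<partial>N)"
      by (rule N.product_nn_integral_prod[OF I meas])
    also have "\<dots> = (\<Prod>i\<in>I. emeasure (density N V) (A i))"
      using A by (intro prod.cong) (simp_all add: emeasure_density)
    finally show "emeasure ?R (Pi\<^sub>E I A) = (\<Prod>i\<in>I. emeasure (density N V) (A i))" .
  qed
  finally show ?thesis .
qed

text \<open>Turns the equality of measures into a change of variables for Bochner integrals; the
  densities are real and non-negative, so they reappear as ordinary factors of the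
  integrand.\<close>

lemma integral_PiM_density_transport:
  fixes W :: "'a \<Rightarrow> real" and V :: "'b \<Rightarrow> real" and F :: "('i \<Rightarrow> 'b) \<Rightarrow> real"
  assumes "finite I" "sigma_finite_measure M" "sigma_finite_measure N" "finite_measure (density N V)"
    and [measurable]: "W \<in> borel_measurable M" "V \<in> borel_measurable N" "\<psi> \<in> measurable M N"
    and [simp]: "\<And>x. W x \<ge> 0" "\<And>x. V x \<ge> 0"
    and transport: "distr (density M W) N \<psi> = density N V"
    and [measurable]: "F \<in> borel_measurable (PiM I (\<lambda>_. N))"
  shows "(\<integral>x. (\<Prod>i\<in>I. W (x i)) * F (\<lambda>i\<in>I. \<psi> (x i)) \<partial>PiM I (\<lambda>_. M)) =
         (\<integral>x. (\<Prod>i\<in>I. V (x i)) * F x \<partial>PiM I (\<lambda>_. N))"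
proof -
  have "(\<integral>x. (\<Prod>i\<in>I. W (x i)) * F (\<lambda>i\<in>I. \<psi> (x i)) \<partial>PiM I (\<lambda>_. M)) =
      (\<integral>x. F x \<partial>distr (density (PiM I (\<lambda>_. M)) (\<lambda>x. ennreal (\<Prod>i\<in>I. W (x i)))) (PiM I (\<lambda>_. N)) (\<lambda>x. \<lambda>i\<in>I. \<psi> (x i)))"
    by (subst integral_distr, measurable, subst integral_density) (auto intro!: prod_nonneg)
  also have "\<dots> = (\<integral>x. F x \<partial>density (PiM I (\<lambda>_. N)) (\<lambda>x. ennreal (\<Prod>i\<in>I. V (x i))))"
    using PiM_density_transport[of I M N "\<lambda>x. ennreal (V x)" "\<lambda>x. ennreal (W x)" \<psi>] assms
    by (simp add: prod_ennreal)
  also have "\<dots> = (\<integral>x. (\<Prod>i\<in>I. V (x i)) * F x \<partial>PiM I (\<lambda>_. N))"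
    by (subst integral_density) (auto intro!: prod_nonneg)
  finally show ?thesis .
qed

text \<open>The rectangle substitution applied to indicators of Borel sets. It provides the
  one-factor \<open>transport\<close> hypothesis of the product lemmas.\<close>

lemma distr_density_rectangle:
  assumes f: "\<And>x. (f has_real_derivative f' x) (at x)" "continuous_on UNIV f'" "\<And>x. f' x \<ge> 0"
    and g: "\<And>x. (g has_real_derivative g' x) (at x)" "continuous_on UNIV g'" "\<And>x. g' x \<ge> 0"
    and "a \<le> b" "c \<le> d"
  shows "distr (density lborel (\<lambda>p. ennreal (f' (fst p) * g' (snd p) * indicator ({a..b} \<times> {c..d}) p)))
           lborel (\<lambda>p. (f (fst p), g (snd p))) =
         density lborel (\<lambda>p. ennreal (indicator ({f a..f b} \<times> {g c..g d}) p))"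
proof (rule measure_eqI)
  fix A assume "A \<in> sets (distr (density lborel (\<lambda>p. ennreal (f' (fst p) * g' (snd p) * indicator ({a..b} \<times> {c..d}) p)))
           lborel (\<lambda>p. (f (fst p), g (snd p))))"
  then have A[measurable]: "A \<in> sets borel" by simp
  have [measurable]: "f \<in> borel_measurable borel" "g \<in> borel_measurable borel"
    using DERIV_isCont[OF f(1)] DERIV_isCont[OF g(1)]
    by (auto intro!: borel_measurable_continuous_onI continuous_at_imp_continuous_on)
  have [measurable]: "f' \<in> borel_measurable borel" "g' \<in> borel_measurable borel"
    using f(2) g(2) by (auto intro: borel_measurable_continuous_onI)
  have [measurable]: "{a..b} \<times> {c..d} \<in> sets (borel :: (real \<times> real) measure)"
    "{f a..f b} \<times> {g c..g d} \<in> sets (borel :: (real \<times> real) measure)"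
    by (intro borel_closed closed_Times closed_atLeastAtMost)+
  have W: "(\<lambda>p. ennreal (f' (fst p) * g' (snd p) * indicator ({a..b} \<times> {c..d}) p)) \<in> borel_measurable lborel"
    unfolding borel_prod[symmetric] lborel_prod[symmetric] by measurable
  have \<psi>: "(\<lambda>p. (f (fst p), g (snd p))) \<in> borel_measurable lborel"
    unfolding borel_prod[symmetric] lborel_prod[symmetric] by measurable
  have "emeasure (distr (density lborel (\<lambda>p. ennreal (f' (fst p) * g' (snd p) * indicator ({a..b} \<times> {c..d}) p)))
           lborel (\<lambda>p. (f (fst p), g (snd p)))) A =
     (\<integral>\<^sup>+p. indicator A p \<partial>distr (density lborel (\<lambda>p. ennreal (f' (fst p) * g' (snd p) * indicator ({a..b} \<times> {c..d}) p)))
           lborel (\<lambda>p. (f (fst p), g (snd p))))"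
    by simp
  also have "\<dots> = (\<integral>\<^sup>+p. ennreal (f' (fst p) * g' (snd p) * indicator ({a..b} \<times> {c..d}) p) *
      indicator A (f (fst p), g (snd p)) \<partial>lborel)"
    using W \<psi> by (subst nn_integral_distr) (simp_all add: nn_integral_density)
  also have "\<dots> = (\<integral>\<^sup>+p. indicator A p * indicator ({f a..f b} \<times> {g c..g d}) p \<partial>lborel)"
    by (subst nn_integral_substitution_rectangle[of "indicator A" f f' g g' a b c d])
      (use assms in \<open>auto simp: mult.commute\<close>)
  also have "\<dots> = emeasure (density lborel (\<lambda>p. ennreal (indicator ({f a..f b} \<times> {g c..g d}) p))) A"
    by (subst emeasure_density) (auto simp: ennreal_indicator mult.commute)
  finally show "emeasure (distr (density lborel (\<lambda>p. ennreal (f' (fst p) * g' (snd p) * indicator ({a..b} \<times> {c..d}) p)))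
           lborel (\<lambda>p. (f (fst p), g (snd p)))) A =
      emeasure (density lborel (\<lambda>p. ennreal (indicator ({f a..f b} \<times> {g c..g d}) p))) A" .
qed simp

section \<open>Measurability of coordinates and of the simplex\<close>

lemma borel_measurable_PiM_coordinates:
  assumes "i < n"
  shows "(\<lambda>r. fst (r i)) \<in> borel_measurable (\<Pi>\<^sub>M i\<in>{..<n}. (lborel :: (real \<times> real) measure))"
    and "(\<lambda>r. snd (r i)) \<in> borel_measurable (\<Pi>\<^sub>M i\<in>{..<n}. (lborel :: (real \<times> real) measure))"
proof -
  have "(\<lambda>r. r i) \<in> borel_measurable (\<Pi>\<^sub>M i\<in>{..<n}. (lborel :: (real \<times> real) measure))"
    using measurable_component_singleton[of i "{..<n}" "\<lambda>_. lborel :: (real \<times> real) measure"] assms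
    by simp
  then show "(\<lambda>r. fst (r i)) \<in> borel_measurable (\<Pi>\<^sub>M i\<in>{..<n}. (lborel :: (real \<times> real) measure))"
    and "(\<lambda>r. snd (r i)) \<in> borel_measurable (\<Pi>\<^sub>M i\<in>{..<n}. (lborel :: (real \<times> real) measure))"
    by (rule borel_measurable_continuous_on[rotated], intro continuous_intros)+
qed

lemma sets_simplex2D: "simplex2D n s t \<in> sets (\<Pi>\<^sub>M i\<in>{..<n}. lborel)"
proof -
  \<comment> \<open>With quantifiers over finite index sets, the simplex is a finite intersection of
    sets cut out by inequalities between measurable coordinates.\<close>
  have "simplex2D n s t = {r \<in> space (\<Pi>\<^sub>M i\<in>{..<n}. lborel).
      (\<forall>i\<in>{..<n}. fst s \<le> fst (r i) \<and> fst (r i) \<le> fst t \<and> snd s \<le> snd (r i) \<and> snd (r i) \<le> snd t) \<and>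
      (\<forall>i\<in>{..<n}. \<forall>j\<in>{i..<n}. fst (r i) \<le> fst (r j) \<and> snd (r i) \<le> snd (r j))}"
    by (auto simp: simplex2D_def space_PiM mono_on_def)
  also have "\<dots> \<in> sets (\<Pi>\<^sub>M i\<in>{..<n}. lborel)"
    by (intro sets.sets_Collect_conj sets.sets_Collect_finite_All borel_measurable_le
        borel_measurable_const borel_measurable_PiM_coordinates) auto
  finally show ?thesis .
qed

section \<open>One-variable derivatives of a stretching\<close>

text \<open>As \<open>\<phi>\<close> splits into coordinates, the derivative of \<open>f\<close> is
  read off along the edge \<open>y = 0\<close> and that of \<open>g\<close> along the edge
  \<open>x = 0\<close>; continuity is inherited from the total derivative.\<close>

lemma C1_on_square_slices:
  fixes \<phi> :: "real \<times> real \<Rightarrow> real \<times> real"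
  assumes "C1_on (square T) \<phi>" "T > 0"
    and \<phi>: "\<And>x y. x \<in> {0..T} \<Longrightarrow> y \<in> {0..T} \<Longrightarrow> \<phi> (x, y) = (f x, g y)"
  obtains f' g' where
    "\<And>x. x \<in> {0..T} \<Longrightarrow> (f has_real_derivative f' x) (at x within {0..T})" "continuous_on {0..T} f'"
    "\<And>x. x \<in> {0..T} \<Longrightarrow> (g has_real_derivative g' x) (at x within {0..T})" "continuous_on {0..T} g'"
proof -
  obtain D :: "real \<times> real \<Rightarrow> (real \<times> real) \<Rightarrow>\<^sub>L (real \<times> real)"
    where D: "\<And>p. p \<in> square T \<Longrightarrow> (\<phi> has_derivative blinfun_apply (D p)) (at p within square T)"
      and cont: "continuous_on (square T) D"
    using assms(1) unfolding C1_on_def by blast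
  \<comment> \<open>In both uses \<open>\<gamma>\<close> runs along an edge of the square with
    constant velocity \<open>v\<close>, and \<open>\<pi>\<close> is a coordinate projection.\<close>
  have slice: "((\<lambda>x. \<pi> (\<phi> (\<gamma> x))) has_real_derivative \<pi> (D (\<gamma> x) v)) (at x within {0..T})"
    if "\<And>x. x \<in> {0..T} \<Longrightarrow> \<gamma> x \<in> square T" "x \<in> {0..T}" "(\<gamma> has_derivative (\<lambda>h. h *\<^sub>R v)) (at x within {0..T})"
      "bounded_linear \<pi>" for \<gamma> :: "real \<Rightarrow> real \<times> real" and v x and \<pi> :: "real \<times> real \<Rightarrow> real"
  proof -
    have "((\<lambda>x. \<phi> (\<gamma> x)) has_derivative (\<lambda>h. D (\<gamma> x) (h *\<^sub>R v))) (at x within {0..T})"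
      by (rule has_derivative_in_compose2[OF D _ that(2,3)]) (use that(1) in auto)
    from bounded_linear.has_derivative[OF that(4) this]
    show ?thesis
      by (simp only: blinfun.scaleR_right linear_cmul[OF bounded_linear.linear[OF that(4)]]
          has_real_derivative_iff_has_vector_derivative has_vector_derivative_def)
  qed
  have f: "(f has_real_derivative fst (D (x, 0) (1, 0))) (at x within {0..T})" if x: "x \<in> {0..T}" for x
  proof -
    have "((\<lambda>x. fst (\<phi> (x, 0))) has_real_derivative fst (D (x, 0) (1, 0))) (at x within {0..T})"
      using \<open>T > 0\<close> x by (intro slice) (auto simp: square_def bounded_linear_fst intro!: derivative_eq_intros)
    from has_field_derivative_transform_within[OF this zero_less_one x, of f] show ?thesis
      using \<open>T > 0\<close> by (auto simp: \<phi>)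
  qed
  have g: "(g has_real_derivative snd (D (0, y) (0, 1))) (at y within {0..T})" if y: "y \<in> {0..T}" for y
  proof -
    have "((\<lambda>y. snd (\<phi> (0, y))) has_real_derivative snd (D (0, y) (0, 1))) (at y within {0..T})"
      using \<open>T > 0\<close> y by (intro slice) (auto simp: square_def bounded_linear_snd intro!: derivative_eq_intros)
    from has_field_derivative_transform_within[OF this zero_less_one y, of g] show ?thesis
      using \<open>T > 0\<close> by (auto simp: \<phi>)
  qed
  have "continuous_on {0..T} (\<lambda>x. fst (D (x, 0) (1, 0)))" "continuous_on {0..T} (\<lambda>y. snd (D (0, y) (0, 1)))"
    using \<open>T > 0\<close>
    by (auto intro!: continuous_intros continuous_on_compose2[OF cont] simp: square_def)
  with f g show ?thesis by (rule_tac that)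
qed

section \<open>Change of variables on ordered configurations\<close>

text \<open>The functions live on the whole line because they are meant to be the extensions of the
  two components of a stretching.\<close>

locale C1_mono_pair =
  fixes f f' g g' :: "real \<Rightarrow> real"
  assumes f: "\<And>x. (f has_real_derivative f' x) (at x)" "continuous_on UNIV f'" "\<And>x. f' x \<ge> 0"
    and g: "\<And>x. (g has_real_derivative g' x) (at x)" "continuous_on UNIV g'" "\<And>x. g' x \<ge> 0"
begin

lemma mono: "mono f" "mono g"
  by (rule monoI, erule DERIV_nonneg_imp_nondecreasing, use f g in blast)+

definition stretch :: "real \<times> real \<Rightarrow> real \<times> real" where
  "stretch p = (f (fst p), g (snd p))"

text \<open>The density of a single point, cut off to the rectangle: \<open>stretch\<close> pushes
  it forward to Lebesgue measure on the image rectangle.\<close>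

definition weight :: "real \<times> real \<Rightarrow> real \<times> real \<Rightarrow> real \<times> real \<Rightarrow> real" where
  "weight s t p = f' (fst p) * g' (snd p) * indicator ({fst s..fst t} \<times> {snd s..snd t}) p"

lemma weight_nonneg: "weight s t p \<ge> 0"
  using f(3) g(3) by (simp add: weight_def)

text \<open>Pulling the image simplex back through \<open>stretch\<close> may give more than the
  original simplex. The excess contributes nothing: outside the box some weight is zero, and inside
  it an inversion flattened by \<open>stretch\<close> makes a derivative factor zero.\<close>

lemma weight_times_indicator_simplex2D:
  assumes "r \<in> {..<n} \<rightarrow>\<^sub>E UNIV"
  shows "(\<Prod>i<n. weight s t (r i)) * indicator (simplex2D n (stretch s) (stretch t)) (\<lambda>i\<in>{..<n}. stretch (r i)) =
    (\<Prod>i<n. f' (fst (r i)) * g' (snd (r i))) * indicator (simplex2D n s t) r"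
proof (cases "\<forall>i<n. r i \<in> {fst s..fst t} \<times> {snd s..snd t}")
  case False
  then obtain i where i: "i < n" "r i \<notin> {fst s..fst t} \<times> {snd s..snd t}" by blast
  then have "(\<Prod>i<n. weight s t (r i)) = 0"
    by (intro prod_zero) (auto simp: weight_def intro!: bexI[of _ i])
  moreover have "r \<notin> simplex2D n s t" using i by (auto simp: simplex2D_def mem_Times_iff)
  ultimately show ?thesis by simp
next
  case True
  then have eq: "(\<Prod>i<n. weight s t (r i)) = (\<Prod>i<n. f' (fst (r i)) * g' (snd (r i)))"
    by (intro prod.cong) (auto simp: weight_def)
  have box: "\<forall>i<n. fst s \<le> fst (r i) \<and> fst (r i) \<le> fst t \<and> snd s \<le> snd (r i) \<and> snd (r i) \<le> snd t"
    using True by (auto simp: mem_Times_iff)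
  show ?thesis
  proof (cases "r \<in> simplex2D n s t")
    case True
    then have "(\<lambda>i\<in>{..<n}. stretch (r i)) \<in> simplex2D n (stretch s) (stretch t)"
      using mono by (auto simp: simplex2D_def stretch_def mono_on_def mono_def)
    with True show ?thesis by (simp add: eq)
  next
    case False
    have "(\<Prod>i<n. f' (fst (r i)) * g' (snd (r i))) = 0"
      if st: "(\<lambda>i\<in>{..<n}. stretch (r i)) \<in> simplex2D n (stretch s) (stretch t)"
    proof -
      have le: "f (fst (r i)) \<le> f (fst (r j)) \<and> g (snd (r i)) \<le> g (snd (r j))"
        if "i \<le> j" "j < n" for i j
        using st that by (auto simp: simplex2D_def stretch_def mono_on_def split: if_splits)
      \<comment> \<open>An inversion: one coordinate of the earlier point \<open>r i\<close> exceeds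
        that of \<open>r j\<close>. The order of the images forces their equality, so the derivative
        at the larger coordinate, which belongs to index \<open>i\<close>, vanishes.\<close>
      obtain i j where ij: "i \<le> j" "j < n" "fst (r j) < fst (r i) \<or> snd (r j) < snd (r i)"
        using False assms box by (fastforce simp: simplex2D_def mono_on_def not_le)
      then have "f' (fst (r i)) * g' (snd (r i)) = 0"
      proof (elim disjE)
        assume less: "fst (r j) < fst (r i)"
        then have "f (fst (r j)) = f (fst (r i))"
          using le[OF ij(1,2)] monoD[OF mono(1), of "fst (r j)" "fst (r i)"] by simp
        with less show ?thesis using mono_deriv_zero[OF mono(1) f(1)] by simp
      next
        assume less: "snd (r j) < snd (r i)"
        then have "g (snd (r j)) = g (snd (r i))"
          using le[OF ij(1,2)] monoD[OF mono(2), of "snd (r j)" "snd (r i)"] by simp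
        with less show ?thesis using mono_deriv_zero[OF mono(2) g(1)] by simp
      qed
      with ij(1,2) show ?thesis by (intro prod_zero) (auto intro!: bexI[of _ i])
    qed
    with False show ?thesis by (simp add: eq split: split_indicator)
  qed
qed

text \<open>The integral is moved to the full product space, where the density is a product over the
  points and can be transported. The ordering constraint does not factor over the points, so its
  indicator travels as part of the integrand.\<close>

lemma integral_simplex2D_stretch:
  fixes F :: "(nat \<Rightarrow> real \<times> real) \<Rightarrow> real"
  assumes [measurable]: "F \<in> borel_measurable (\<Pi>\<^sub>M i\<in>{..<n}. lborel)"
    and "fst s \<le> fst t" "snd s \<le> snd t"
  shows "(LINT r : simplex2D n s t | (\<Pi>\<^sub>M i\<in>{..<n}. lborel).
            (\<Prod>i<n. f' (fst (r i)) * g' (snd (r i))) * F (\<lambda>i\<in>{..<n}. stretch (r i))) =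
         (LINT r : simplex2D n (stretch s) (stretch t) | (\<Pi>\<^sub>M i\<in>{..<n}. lborel). F r)"
proof -
  have [measurable]: "f \<in> borel_measurable borel" "g \<in> borel_measurable borel"
    using DERIV_isCont[OF f(1)] DERIV_isCont[OF g(1)]
    by (auto intro!: borel_measurable_continuous_onI continuous_at_imp_continuous_on)
  have [measurable]: "f' \<in> borel_measurable borel" "g' \<in> borel_measurable borel"
    using f(2) g(2) by (auto intro: borel_measurable_continuous_onI)
  have W: "weight s t \<in> borel_measurable lborel"
    unfolding weight_def borel_prod[symmetric] lborel_prod[symmetric] by measurable
  have \<psi>: "stretch \<in> measurable lborel lborel"
    unfolding stretch_def borel_prod[symmetric] lborel_prod[symmetric] by measurable
  define B where "B = {f (fst s)..f (fst t)} \<times> {g (snd s)..g (snd t)}"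
  have B: "B = cbox (stretch s) (stretch t)"
    by (auto simp: B_def stretch_def cbox_Pair_eq)
  have V: "finite_measure (density lborel (\<lambda>p. ennreal (indicator B p)))"
    using emeasure_lborel_cbox_finite[of "stretch s" "stretch t"]
    by (intro finite_measureI) (simp add: B emeasure_density ennreal_indicator less_top)
  have S: "simplex2D n (stretch s) (stretch t) \<in> sets (\<Pi>\<^sub>M i\<in>{..<n}. lborel)" by (rule sets_simplex2D)
  have "(LINT r : simplex2D n s t | (\<Pi>\<^sub>M i\<in>{..<n}. lborel).
            (\<Prod>i<n. f' (fst (r i)) * g' (snd (r i))) * F (\<lambda>i\<in>{..<n}. stretch (r i))) =
    (\<integral>r. (\<Prod>i<n. weight s t (r i)) *
        (indicator (simplex2D n (stretch s) (stretch t)) (\<lambda>i\<in>{..<n}. stretch (r i)) * F (\<lambda>i\<in>{..<n}. stretch (r i)))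
      \<partial>(\<Pi>\<^sub>M i\<in>{..<n}. lborel))"
    unfolding set_lebesgue_integral_def
  proof (rule Bochner_Integration.integral_cong[OF refl])
    fix r :: "nat \<Rightarrow> real \<times> real" assume "r \<in> space (\<Pi>\<^sub>M i\<in>{..<n}. lborel)"
    then have "r \<in> {..<n} \<rightarrow>\<^sub>E UNIV" by (simp add: space_PiM)
    from weight_times_indicator_simplex2D[OF this, of s t]
    show "indicator (simplex2D n s t) r *\<^sub>R
        ((\<Prod>i<n. f' (fst (r i)) * g' (snd (r i))) * F (\<lambda>i\<in>{..<n}. stretch (r i))) =
      (\<Prod>i<n. weight s t (r i)) *
        (indicator (simplex2D n (stretch s) (stretch t)) (\<lambda>i\<in>{..<n}. stretch (r i)) * F (\<lambda>i\<in>{..<n}. stretch (r i)))"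
      by (simp only: mult.assoc[symmetric] real_scaleR_def) (simp only: mult_ac)
  qed
  also have "\<dots> = (\<integral>r. (\<Prod>i<n. indicator B (r i)) * (indicator (simplex2D n (stretch s) (stretch t)) r * F r)
      \<partial>(\<Pi>\<^sub>M i\<in>{..<n}. lborel))"
  proof (rule integral_PiM_density_transport[OF _ _ _ V W _ \<psi>])
    show "distr (density lborel (\<lambda>x. ennreal (weight s t x))) lborel stretch =
        density lborel (\<lambda>p. ennreal (indicator B p))"
      unfolding weight_def[abs_def] stretch_def[abs_def] B_def
      by (rule distr_density_rectangle) (use f g assms in auto)
    show "(\<lambda>r. indicator (simplex2D n (stretch s) (stretch t)) r * F r) \<in> borel_measurable (\<Pi>\<^sub>M i\<in>{..<n}. lborel)"
      using S by measurable
  qed (auto simp: weight_nonneg B lborel.sigma_finite_measure_axioms)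
  also have "\<dots> = (LINT r : simplex2D n (stretch s) (stretch t) | (\<Pi>\<^sub>M i\<in>{..<n}. lborel). F r)"
    unfolding set_lebesgue_integral_def
  proof (intro Bochner_Integration.integral_cong refl)
    fix r :: "nat \<Rightarrow> real \<times> real"
    \<comment> \<open>All points of a configuration in the image simplex lie in \<open>B\<close>, so
      the box indicators left by the transport equal 1 there.\<close>
    have "r i \<in> B" if "r \<in> simplex2D n (stretch s) (stretch t)" "i < n" for i
      using that by (auto simp: B_def simplex2D_def stretch_def mem_Times_iff)
    then show "(\<Prod>i<n. indicator B (r i)) * (indicator (simplex2D n (stretch s) (stretch t)) r * F r) =
        indicator (simplex2D n (stretch s) (stretch t)) r *\<^sub>R F r"
      by (auto split: split_indicator)
  qed
  finally show ?thesis .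
qed

end

section \<open>Invariance of the signature coefficients\<close>

lemma borel_measurable_signature_integrand:
  fixes G :: "real \<times> real \<Rightarrow> real ^ 'd::finite"
  assumes [measurable]: "G \<in> borel_measurable borel" and \<nu>: "\<nu> permutes {..<n}"
  shows "(\<lambda>r. \<Prod>i<n. G (fst (r i), snd (r (\<nu> i))) $ w i) \<in> borel_measurable (\<Pi>\<^sub>M i\<in>{..<n}. lborel)"
proof (rule borel_measurable_prod)
  fix i assume i: "i \<in> {..<n}"
  have "\<nu> i < n" using permutes_in_image[OF \<nu>] i by auto
  with i have "(\<lambda>r. (fst (r i), snd (r (\<nu> i)))) \<in>
      borel_measurable (\<Pi>\<^sub>M i\<in>{..<n}. (lborel :: (real \<times> real) measure))"
    by (intro borel_measurable_Pair borel_measurable_PiM_coordinates) auto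
  moreover have "(\<lambda>p. G p $ w i) \<in> borel_measurable borel"
    by (rule borel_measurable_continuous_on[OF _ assms(1)]) (intro continuous_intros)
  ultimately show "(\<lambda>r. G (fst (r i), snd (r (\<nu> i))) $ w i) \<in> borel_measurable (\<Pi>\<^sub>M i\<in>{..<n}. lborel)"
    by (rule measurable_compose)
qed

text \<open>The chain rule turns the integrand of the stretched field at \<open>r\<close> into
  derivative factors times the integrand of \<open>X\<close> at the stretched configuration, which
  is the shape handled by \<open>integral_simplex2D_stretch\<close>.\<close>

lemma sig2D_stretching:
  fixes X :: "real \<times> real \<Rightarrow> real ^ 'd::finite" and w :: "'d list"
  assumes T: "T > 0" and X: "C2_on (square T) X" and \<phi>: "stretching T \<phi>"
    and s: "s \<in> square T" and t: "t \<in> square T" and le: "fst s \<le> fst t" "snd s \<le> snd t"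
    and \<nu>: "\<nu> permutes {..<length w}"
  shows "sig2D T (\<lambda>p. X (\<phi> p)) s t w \<nu> = sig2D T X (\<phi> s) (\<phi> t) w \<nu>"
proof -
  let ?n = "length w"
  obtain \<phi>1 \<phi>2 where \<phi>_eq: "\<And>x y. x \<in> {0..T} \<Longrightarrow> y \<in> {0..T} \<Longrightarrow> \<phi> (x, y) = (\<phi>1 x, \<phi>2 y)"
    and ran: "\<phi>1 ` {0..T} \<subseteq> {0..T}" "\<phi>2 ` {0..T} \<subseteq> {0..T}"
    and mono: "mono_on {0..T} \<phi>1" "mono_on {0..T} \<phi>2" and C1: "C1_on (square T) \<phi>"
    using \<phi> unfolding stretching_def by (auto simp: image_subset_iff_funcset)
  obtain d1 d2 where
    d1: "\<And>x. x \<in> {0..T} \<Longrightarrow> (\<phi>1 has_real_derivative d1 x) (at x within {0..T})" "continuous_on {0..T} d1" and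
    d2: "\<And>x. x \<in> {0..T} \<Longrightarrow> (\<phi>2 has_real_derivative d2 x) (at x within {0..T})" "continuous_on {0..T} d2"
    using C1_on_square_slices[OF C1 T \<phi>_eq] by blast
  obtain f f' where f: "\<And>x. (f has_real_derivative f' x) (at x)" "continuous_on UNIV f'" "\<And>x. f' x \<ge> 0"
    and f_eq: "\<And>x. x \<in> {0..T} \<Longrightarrow> f x = \<phi>1 x" "\<And>x. x \<in> {0..T} \<Longrightarrow> f' x = d1 x"
    using C1_mono_extension[OF T mono(1) d1] by blast
  obtain g g' where g: "\<And>x. (g has_real_derivative g' x) (at x)" "continuous_on UNIV g'" "\<And>x. g' x \<ge> 0"
    and g_eq: "\<And>x. x \<in> {0..T} \<Longrightarrow> g x = \<phi>2 x" "\<And>x. x \<in> {0..T} \<Longrightarrow> g' x = d2 x"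
    using C1_mono_extension[OF T mono(2) d2] by blast
  interpret C1_mono_pair f f' g g' by unfold_locales (fact f g)+
  have \<phi>_stretch: "\<phi> p = stretch p" if "p \<in> square T" for p
    using that by (cases p) (auto simp: square_def stretch_def \<phi>_eq f_eq g_eq)
  have \<phi>_square: "\<phi> p \<in> square T" if "p \<in> square T" for p
    using that ran by (cases p) (auto simp: square_def \<phi>_eq image_subset_iff)
  have partial: "partial12 T (\<lambda>p. X (\<phi> p)) p = (f' (fst p) * g' (snd p)) *\<^sub>R partial12 T X (stretch p)"
    if "p \<in> square T" for p
  proof -
    obtain x y where p: "p = (x, y)" by (cases p)
    with that have x: "x \<in> {0..T}" and y: "y \<in> {0..T}" by (auto simp: square_def)
    show ?thesis
      using partial12_compose[OF T X \<phi>_eq ran x y d1(1)[OF x] d2(1)[OF y]] x y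
      by (simp add: p stretch_def f_eq g_eq)
  qed
  \<comment> \<open>Only the values of \<open>partial12 T X\<close> on the square are controlled;
    setting it to zero elsewhere gives a Borel function on the plane, so that \<open>F\<close> is
    measurable on the whole product space.\<close>
  define G where "G p = indicator (square T) p *\<^sub>R partial12 T X p" for p
  have G: "G \<in> borel_measurable borel"
    unfolding G_def using continuous_on_partial12[OF T X]
    by (intro borel_measurable_continuous_on_indicator borel_closed)
      (auto simp: square_def intro!: closed_Times)
  \<comment> \<open>This point takes its coordinates from two different points of the configuration;
    it stays in the square because the square is a product.\<close>
  have mem: "(fst (r i), snd (r (\<nu> i))) \<in> square T"
    if "r \<in> simplex2D ?n a b" "a \<in> square T" "b \<in> square T" "i < ?n" for r a b i
  proof -
    have "\<nu> i < ?n" using permutes_in_image[OF \<nu>] that(4) by auto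
    with that show ?thesis by (force simp: simplex2D_def square_def)
  qed
  define F where "F r = (\<Prod>i<?n. G (fst (r i), snd (r (\<nu> i))) $ (w ! i))" for r
  have F: "F \<in> borel_measurable (\<Pi>\<^sub>M i\<in>{..<?n}. lborel)"
    unfolding F_def by (rule borel_measurable_signature_integrand[OF G \<nu>])
  have "sig2D T (\<lambda>p. X (\<phi> p)) s t w \<nu> =
    (LINT r : simplex2D ?n s t | (\<Pi>\<^sub>M i\<in>{..<?n}. lborel).
            (\<Prod>i<?n. f' (fst (r i)) * g' (snd (r i))) * F (\<lambda>i\<in>{..<?n}. stretch (r i)))"
    unfolding sig2D_def
  proof (rule set_lebesgue_integral_cong[OF sets_simplex2D], intro allI impI)
    fix r assume r: "r \<in> simplex2D ?n s t"
    \<comment> \<open>The chain rule yields \<open>g'\<close> at the permuted points. Reindexing the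
      full product removes \<open>\<nu>\<close> from the density, leaving it only in
      \<open>F\<close>.\<close>
    have perm: "(\<Prod>i<?n. g' (snd (r (\<nu> i)))) = (\<Prod>i<?n. g' (snd (r i)))"
      using prod.permute[OF \<nu>, of "\<lambda>i. g' (snd (r i))"] by (simp add: comp_def)
    have "(\<Prod>i<?n. partial12 T (\<lambda>p. X (\<phi> p)) (fst (r i), snd (r (\<nu> i))) $ (w ! i)) =
      (\<Prod>i<?n. f' (fst (r i)) * g' (snd (r (\<nu> i))) *
          G (fst (stretch (r i)), snd (stretch (r (\<nu> i)))) $ (w ! i))"
    proof (rule prod.cong[OF refl])
      fix i assume "i \<in> {..<?n}"
      then have m: "(fst (r i), snd (r (\<nu> i))) \<in> square T" using mem[OF r s t] by simp
      then have "stretch (fst (r i), snd (r (\<nu> i))) \<in> square T"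
        using \<phi>_square[OF m] by (simp add: \<phi>_stretch)
      then show "partial12 T (\<lambda>p. X (\<phi> p)) (fst (r i), snd (r (\<nu> i))) $ (w ! i) =
        f' (fst (r i)) * g' (snd (r (\<nu> i))) * G (fst (stretch (r i)), snd (stretch (r (\<nu> i)))) $ (w ! i)"
        by (simp add: partial[OF m] G_def stretch_def)
    qed
    also have "\<dots> = (\<Prod>i<?n. f' (fst (r i)) * g' (snd (r i))) *
        (\<Prod>i<?n. G (fst (stretch (r i)), snd (stretch (r (\<nu> i)))) $ (w ! i))"
      by (simp add: prod.distrib perm)
    \<comment> \<open>\<open>\<nu>\<close> maps the index range into itself, so the restricted
      function inside \<open>F\<close> is never evaluated at an index where it is
      \<open>undefined\<close>.\<close>
    also have "(\<Prod>i<?n. G (fst (stretch (r i)), snd (stretch (r (\<nu> i)))) $ (w ! i)) =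
        F (\<lambda>i\<in>{..<?n}. stretch (r i))"
      unfolding F_def using permutes_in_image[OF \<nu>] by (intro prod.cong) auto
    finally show "(\<Prod>i<?n. partial12 T (\<lambda>p. X (\<phi> p)) (fst (r i), snd (r (\<nu> i))) $ (w ! i)) =
      (\<Prod>i<?n. f' (fst (r i)) * g' (snd (r i))) * F (\<lambda>i\<in>{..<?n}. stretch (r i))" .
  qed
  also have "\<dots> = (LINT r : simplex2D ?n (stretch s) (stretch t) | (\<Pi>\<^sub>M i\<in>{..<?n}. lborel). F r)"
    by (rule integral_simplex2D_stretch[OF F le])
  also have "\<dots> = sig2D T X (stretch s) (stretch t) w \<nu>"
    unfolding sig2D_def
  proof (rule set_lebesgue_integral_cong[OF sets_simplex2D], intro allI impI)
    fix r assume r: "r \<in> simplex2D ?n (stretch s) (stretch t)"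
    have "stretch s \<in> square T" "stretch t \<in> square T"
      using \<phi>_square s t by (simp_all flip: \<phi>_stretch)
    from mem[OF r this]
    show "F r = (\<Prod>i<?n. partial12 T X (fst (r i), snd (r (\<nu> i))) $ (w ! i))"
      unfolding F_def by (intro prod.cong) (auto simp: G_def)
  qed
  finally show ?thesis using s t by (simp only: \<phi>_stretch)
qed

theorem mainTheorem11:
  fixes T :: real
    and X :: "real \<times> real \<Rightarrow> real ^ 'd"
    and \<phi> :: "real \<times> real \<Rightarrow> real \<times> real"
  assumes "T > 0"
    and "C2_on (square T) X"
    and "stretching T \<phi>"
  shows "(\<forall>s\<in>square T. \<forall>t\<in>square T. fst s \<le> fst t \<longrightarrow> snd s \<le> snd t \<longrightarrow>
            (\<forall>(w :: 'd list) \<nu>. \<nu> permutes {..<length w} \<longrightarrow>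
               sig2D T (\<lambda>p. X (\<phi> p)) s t w \<nu> = sig2D T X (\<phi> s) (\<phi> t) w \<nu>)) \<and>
         (\<forall>(w :: 'd list) \<nu>. \<nu> permutes {..<length w} \<longrightarrow>
            sig2D T (\<lambda>p. X (\<phi> p)) (0, 0) (T, T) w \<nu> = sig2D T X (0, 0) (T, T) w \<nu>)"
proof -
  have main: "sig2D T (\<lambda>p. X (\<phi> p)) s t w \<nu> = sig2D T X (\<phi> s) (\<phi> t) w \<nu>"
    if "s \<in> square T" "t \<in> square T" "fst s \<le> fst t" "snd s \<le> snd t" "\<nu> permutes {..<length w}"
    for s t \<nu> and w :: "'d list"
    using sig2D_stretching[OF assms that] .
  \<comment> \<open>A stretching fixes both corners, so invariance over the whole square is the
    general identity at these corners.\<close>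
  have ends: "\<phi> (0, 0) = (0, 0)" "\<phi> (T, T) = (T, T)"
    using assms(1,3) unfolding stretching_def by fastforce+
  have "sig2D T (\<lambda>p. X (\<phi> p)) (0, 0) (T, T) w \<nu> = sig2D T X (0, 0) (T, T) w \<nu>"
    if "\<nu> permutes {..<length w}" for \<nu> and w :: "'d list"
    using main[of "(0, 0)" "(T, T)" \<nu> w] that assms(1) unfolding ends by (simp add: square_def)
  with main show ?thesis by blast
qed

end
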